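(* Any data structure $\tilde{\mathcal{L}}(\cdot)$ that, with probability at least $2/3$, is an $\epsilon$-relative error approximation to the logistic loss for an input $(\mathbf{X}, \mathbf{y})$, $\mathbf{X}\in\mathbb{R}^{n\times d}$, $\mathbf{y}\in\{-1,1\}^n$, requires $\tilde{\Omega}\left(\frac{d}{\epsilon^2}\right)$ bits of space in the worst case over inputs, assuming that $d = \Omega(\log 1/\epsilon)$, $n = \tilde{\Omega}\left(d\epsilon^{-2}\right)$, and $0 < \epsilon \leq \epsilon_0$ for some sufficiently small constant $\epsilon_0>0$.
   Context: The logistic loss is $\mathcal{L}(\beta) = \sum_{i=1}^n \log(1 + e^{-\mathbf{y}_i\mathbf{x}_i^T\beta})$, where $\mathbf{x}_i^T$ are the rows of $\mathbf{X}$. A data structure $\tilde{\mathcal{L}}(\cdot)$ is an $\epsilon$-relative error approximation to the logistic loss if $(1-\epsilon)\mathcal{L}(\beta) \leq \tilde{\mathcal{L}}(\beta) \leq (1+\epsilon) \mathcal{L}(\beta)$ for all $\beta\in\mathbb{R}^d$. A data structure is any stored bit representation with an arbitrary (unbounded-time, possibly randomized) query procedure returning a real number for each query $\beta$; space is the number of stored bits. Entries of $\mathbf{X}$ are specifiable in $\mathcal{O}(\log nd)$ bits. $\tilde{\Omega}(\cdot)$ suppresses logarithmic factors in $n,d,1/\epsilon$. *)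

theory Defs
  imports "HOL-Probability.Probability" "Jordan_Normal_Form.Matrix"
begin

no_notation inner (infix "\<bullet>" 70)
no_notation vec_nth (infixl "$" 90)

definition logistic_loss :: "real mat \<Rightarrow> real vec \<Rightarrow> real vec \<Rightarrow> real" where
  "logistic_loss X y \<beta> = (\<Sum>i<dim_row X. ln (1 + exp (- (y $ i * (row X i \<bullet> \<beta>)))))"

definition rel_error_approx ::
    "real \<Rightarrow> real mat \<Rightarrow> real vec \<Rightarrow> (real vec \<Rightarrow> real) \<Rightarrow> bool" where
  "rel_error_approx \<epsilon> X y L \<longleftrightarrow>
     (\<forall>\<beta> \<in> carrier_vec (dim_col X).
        (1 - \<epsilon>) * logistic_loss X y \<beta> \<le> L \<beta> \<and> L \<beta> \<le> (1 + \<epsilon>) * logistic_loss X y \<beta>)"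

text \<open>Admissible inputs. ``Entries specifiable in \<open>O(log (n d))\<close> bits'' is rendered as: the entries are
  integers of absolute value at most \<open>(n d)\<^sup>K\<close>, i.e. of at most about \<open>K log (n d)\<close> bits, for a
  constant \<open>K\<close>. Shrinking the class of inputs only makes a lower bound on space stronger.\<close>

definition inputs :: "real \<Rightarrow> nat \<Rightarrow> nat \<Rightarrow> (real mat \<times> real vec) set" where
  "inputs K n d = {(X, y). X \<in> carrier_mat n d \<and> y \<in> carrier_vec n \<and>
     (\<forall>i<n. \<forall>j<d. X $$ (i, j) \<in> \<int> \<and> \<bar>X $$ (i, j)\<bar> \<le> real (n * d) powr K) \<and>
     (\<forall>i<n. y $ i \<in> {-1, 1})}"

text \<open>A deterministic data structure turns an input into a stored bit string, and answers queries
  from the stored bit string alone.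

  A randomized data structure is a probability measure on deterministic ones, over an arbitrary
  sigma-algebra. If the storing and the query procedures use random bits \<open>\<omega>\<close> from any probability
  space, the push-forward along the map taking \<open>\<omega>\<close> to the resulting deterministic data structure
  (with the final sigma-algebra) is such a measure. Private randomness of either procedure and
  randomness shared by the two are both covered; random bits are not counted as space unless they
  are stored.\<close>

datatype data_structure = Data_Structure
  (store: "real mat \<Rightarrow> real vec \<Rightarrow> bool list")
  (query: "bool list \<Rightarrow> real vec \<Rightarrow> real")

text \<open>The approximation guarantee is simultaneous over all \<open>\<beta>\<close>: the quantifier over \<open>\<beta>\<close> is inside
  the event.\<close>

definition approximates_logistic_loss ::
    "real \<Rightarrow> real \<Rightarrow> nat \<Rightarrow> nat \<Rightarrow> data_structure measure \<Rightarrow> bool" where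
  "approximates_logistic_loss \<epsilon> K n d M \<longleftrightarrow>
     (\<forall>(X, y) \<in> inputs K n d.
        measure M {D \<in> space M. rel_error_approx \<epsilon> X y (query D (store D X y))} \<ge> 2 / 3)"

definition uses_space :: "real \<Rightarrow> nat \<Rightarrow> nat \<Rightarrow> data_structure measure \<Rightarrow> nat \<Rightarrow> bool" where
  "uses_space K n d M s \<longleftrightarrow>
     (\<forall>(X, y) \<in> inputs K n d. AE D in M. length (store D X y) \<le> s)"

text \<open>\<open>polylog n d \<epsilon> k\<close> is the form of the logarithmic factors suppressed by the tilde in
  \<open>\<Omega>\<close>-notation: any product of powers of \<open>ln n\<close>, \<open>ln d\<close> and \<open>ln (1/\<epsilon>)\<close> is at most
  \<open>polylog n d \<epsilon> k\<close> for some \<open>k\<close>, when \<open>n, d \<ge> 1\<close> and \<open>\<epsilon> \<le> 1\<close>.\<close>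

definition polylog :: "nat \<Rightarrow> nat \<Rightarrow> real \<Rightarrow> nat \<Rightarrow> real" where
  "polylog n d \<epsilon> k = ln (real n * real d / \<epsilon>) ^ k"

end

theory Submission imports Defs begin

text \<open>
  In fact about \<open>n\<close> bits are needed, for any constant \<open>\<epsilon> \<le> 1/2\<close>. Take \<open>n\<close> distinct integer points
  \<open>p\<^sub>0, \<dots>, p\<^sub>n\<^sub>-\<^sub>1\<close> of a grid of constant dimension \<open>k\<close>, and lift them to a paraboloid, so that some
  query \<open>\<beta>\<close> gives row \<open>i\<close> the margin \<open>t (\<bar>p\<^sub>i - p\<^sub>l\<bar>\<^sup>2 - 1/2)\<close>, which is negative for \<open>i = l\<close> only. A
  further \<open>0/1\<close> column lifts the margin of the rows in a set \<open>S\<close> by \<open>t\<close>. For large \<open>t\<close> the loss is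
  then close to \<open>0\<close> if \<open>l \<in> S\<close> and at least \<open>ln 2\<close> otherwise. Hence no function approximates the
  losses of two different sets \<open>S\<close>, and a data structure that is correct on an average of two thirds
  of the \<open>2\<^sup>n\<close> sets needs as many bit strings.
\<close>

section \<open>Counting stored bit strings against separated inputs\<close>

lemma card_bool_lists_length_le: "card {xs :: bool list. length xs \<le> s} = 2 ^ (s + 1) - 1"
  using card_lists_length_le[of "UNIV :: bool set" s] sum_power2[of "s + 1"]
  by (simp add: atLeast0AtMost atLeast0LessThan lessThan_Suc_atMost)

lemma finite_bool_lists_length_le: "finite {xs :: bool list. length xs \<le> s}"
  using finite_lists_length_le[of "UNIV :: bool set" s] by simp

text \<open>By linearity of expectation the sum is the expected number of events that occur, and
  that number never exceeds \<open>N\<close>.\<close>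

lemma (in prob_space) sum_prob_le_of_overlap_le:
  assumes "finite I" and "\<And>i. i \<in> I \<Longrightarrow> E i \<in> events"
    and overlap: "\<And>x. x \<in> space M \<Longrightarrow> real (card {i \<in> I. x \<in> E i}) \<le> N"
  shows "(\<Sum>i\<in>I. prob (E i)) \<le> N"
proof -
  have ind: "(\<Sum>i\<in>I. indicator (E i) x) = real (card {i \<in> I. x \<in> E i})" for x
    using \<open>finite I\<close> by (simp add: indicator_def of_bool_def sum.If_cases Int_def)
  have int: "integrable M (\<lambda>x. indicator (E i) x :: real)" if "i \<in> I" for i
    using assms(2)[OF that] by (simp add: emeasure_eq_measure)
  have "(\<Sum>i\<in>I. prob (E i)) = (\<Sum>i\<in>I. expectation (indicator (E i)))"
    using assms(2) by (intro sum.cong) (auto simp: Int_absorb1 sets.sets_into_space)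
  also have "\<dots> = expectation (\<lambda>x. \<Sum>i\<in>I. indicator (E i) x)"
    using int by (subst Bochner_Integration.integral_sum) auto
  also have "\<dots> \<le> N"
    using int by (intro integral_le_const Bochner_Integration.integrable_sum AE_I2)
      (auto simp: ind overlap)
  finally show ?thesis .
qed

text \<open>Fix a deterministic \<open>D\<close>. The inputs on which it succeeds have distinct
  stored strings, since a shared string would yield one function approximating both losses. So
  \<open>D\<close> succeeds on at most as many inputs as there are strings of length at most
  \<open>s\<close>; averaging over \<open>D\<close> compares this with the success probability
  2/3.\<close>

lemma space_bound_of_packing:
  fixes X :: "'i \<Rightarrow> real mat" and y :: "'i \<Rightarrow> real vec"
  assumes "prob_space M" and approx: "approximates_logistic_loss \<epsilon> K n d M"
    and space: "uses_space K n d M s"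
    and "finite I" and inputs: "\<And>i. i \<in> I \<Longrightarrow> (X i, y i) \<in> inputs K n d"
    and separated: "\<And>i j L. \<lbrakk>i \<in> I; j \<in> I; rel_error_approx \<epsilon> (X i) (y i) L;
      rel_error_approx \<epsilon> (X j) (y j) L\<rbrakk> \<Longrightarrow> i = j"
  shows "2 / 3 * real (card I) \<le> 2 ^ (s + 1) - 1"
proof -
  interpret prob_space M by fact
  define good where "good i E \<longleftrightarrow> E \<in> events \<and> 2 / 3 \<le> prob E \<and>
    (\<forall>D\<in>E. length (store D (X i) (y i)) \<le> s \<and>
      rel_error_approx \<epsilon> (X i) (y i) (query D (store D (X i) (y i))))" for i E
  have "\<exists>E. good i E" if "i \<in> I" for i
  proof -
    define G where "G = {D \<in> space M. rel_error_approx \<epsilon> (X i) (y i) (query D (store D (X i) (y i)))}"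
    have G: "2 / 3 \<le> prob G"
      using bspec[OF approx[unfolded approximates_logistic_loss_def] inputs[OF that]]
      by (simp add: G_def)
    \<comment> \<open>The measure of a non-measurable set is 0 by convention, so the bound 2/3
      forces measurability.\<close>
    then have "G \<in> events" using measure_notin_sets[of G M] by linarith
    have "AE D in M. length (store D (X i) (y i)) \<le> s"
      using bspec[OF space[unfolded uses_space_def] inputs[OF that]] by simp
    then obtain N where N: "{D \<in> space M. \<not> length (store D (X i) (y i)) \<le> s} \<subseteq> N"
        "emeasure M N = 0" "N \<in> events"
      by (rule AE_E)
    \<comment> \<open>Cutting out the null set turns the almost sure space bound into one that holds
      at every point of the event, as the pointwise count of strings requires.\<close>
    have "prob (G - N) = prob G"
      using N \<open>G \<in> events\<close> by (intro measure_Diff_null_set) auto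
    then show ?thesis
      using G N \<open>G \<in> events\<close> by (intro exI[of _ "G - N"]) (auto simp: good_def G_def)
  qed
  then obtain E where "\<And>i. i \<in> I \<Longrightarrow> good i (E i)" by metis
  then have E: "\<And>i. i \<in> I \<Longrightarrow> E i \<in> events" "\<And>i. i \<in> I \<Longrightarrow> 2 / 3 \<le> prob (E i)"
      "\<And>i D. i \<in> I \<Longrightarrow> D \<in> E i \<Longrightarrow> length (store D (X i) (y i)) \<le> s \<and>
      rel_error_approx \<epsilon> (X i) (y i) (query D (store D (X i) (y i)))"
    unfolding good_def by simp_all
  have "real (card {i \<in> I. D \<in> E i}) \<le> 2 ^ (s + 1) - 1" for D
  proof -
    have "card {i \<in> I. D \<in> E i} \<le> card {xs :: bool list. length xs \<le> s}"
    proof (rule card_inj_on_le[where f = "\<lambda>i. store D (X i) (y i)"])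
      show "inj_on (\<lambda>i. store D (X i) (y i)) {i \<in> I. D \<in> E i}"
      proof (rule inj_onI)
        fix i j
        assume ij: "i \<in> {i \<in> I. D \<in> E i}" "j \<in> {i \<in> I. D \<in> E i}"
          and eq: "store D (X i) (y i) = store D (X j) (y j)"
        have "rel_error_approx \<epsilon> (X j) (y j) (query D (store D (X i) (y i)))"
          unfolding eq using ij(2) E(3) by simp
        with ij E(3) show "i = j" by (intro separated[of i j]) simp_all
      qed
      show "(\<lambda>i. store D (X i) (y i)) ` {i \<in> I. D \<in> E i} \<subseteq> {xs. length xs \<le> s}"
        using E(3) by (simp add: image_subset_iff)
    qed (rule finite_bool_lists_length_le)
    then have "real (card {i \<in> I. D \<in> E i}) \<le> real (2 ^ (s + 1) - 1)"
      unfolding card_bool_lists_length_le by (rule of_nat_mono)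
    also have "\<dots> = 2 ^ (s + 1) - 1"
      by (subst of_nat_diff) simp_all
    finally show ?thesis .
  qed
  then have "(\<Sum>i\<in>I. prob (E i)) \<le> 2 ^ (s + 1) - 1"
    using E(1) \<open>finite I\<close> by (intro sum_prob_le_of_overlap_le) auto
  moreover have "2 / 3 * real (card I) \<le> (\<Sum>i\<in>I. prob (E i))"
    using sum_mono[of I "\<lambda>_. 2 / 3" "\<lambda>i. prob (E i)"] E(2) by simp
  ultimately show ?thesis by linarith
qed

section \<open>Hard inputs and their losses\<close>

text \<open>The squares of the coordinates make squared distances linear in the row. They occupy
  separate columns, as their sum could exceed the bound on entries by a factor \<open>k\<close>. The
  set \<open>S\<close> is encoded in a column; the labels are constant.\<close>

definition hard_matrix :: "nat \<Rightarrow> nat \<Rightarrow> nat \<Rightarrow> (nat \<Rightarrow> nat \<Rightarrow> nat) \<Rightarrow> nat set \<Rightarrow> real mat" where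
  "hard_matrix n d k p S = mat n d (\<lambda>(i, j).
     if j < k then real (p i j) else if j < 2 * k then (real (p i (j - k)))\<^sup>2
     else if j = 2 * k then 1 else if j = 2 * k + 1 then of_bool (i \<in> S) else 0)"

text \<open>These are the coefficients of \<open>t\<close> times (squared distance to
  \<open>c\<close>, minus 1/2, plus the indicator of \<open>S\<close>). The shift 1/2 lies between 0
  and 1, the two least possible squared distances of integer points.\<close>

definition probe :: "nat \<Rightarrow> nat \<Rightarrow> real \<Rightarrow> (nat \<Rightarrow> nat) \<Rightarrow> real vec" where
  "probe d k t c = Matrix.vec d (\<lambda>j.
     if j < k then - 2 * t * real (c j) else if j < 2 * k then t
     else if j = 2 * k then t * ((\<Sum>j<k. (real (c j))\<^sup>2) - 1 / 2) else if j = 2 * k + 1 then t else 0)"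

definition ones :: "nat \<Rightarrow> real vec" where "ones n = Matrix.vec n (\<lambda>_. 1)"

lemma sum_blocks:
  fixes f g :: "nat \<Rightarrow> real"
  assumes "2 * k + 2 \<le> d"
  shows "(\<Sum>j = 0..<d. if j < k then f j else if j < 2 * k then g (j - k)
      else if j = 2 * k then u else if j = 2 * k + 1 then v else 0)
    = (\<Sum>j<k. f j) + (\<Sum>j<k. g j) + u + v" (is "sum ?h _ = _")
proof -
  have "sum ?h {0..<d} = sum ?h {0..<Suc (Suc (k + k))}"
    using assms by (intro sum.mono_neutral_right) auto
  also have "\<dots> = sum ?h {0..<k + k} + u + v"
    by simp
  also have "sum ?h {0..<k + k} = sum ?h {0..<k} + sum ?h {k..<k + k}"
    by (rule sum.atLeastLessThan_concat[symmetric]) simp_all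
  also have "sum ?h {k..<k + k} = (\<Sum>j<k. g j)"
    using sum.shift_bounds_nat_ivl[of ?h 0 k k] by (simp add: atLeast0LessThan)
  finally show ?thesis by (simp add: atLeast0LessThan)
qed

lemma hard_matrix_margin:
  assumes "2 * k + 2 \<le> d" and "i < n"
  shows "row (hard_matrix n d k p S) i \<bullet> probe d k t c
    = t * ((\<Sum>j<k. (real (p i j) - real (c j))\<^sup>2) - 1 / 2 + of_bool (i \<in> S))"
proof -
  have "row (hard_matrix n d k p S) i \<bullet> probe d k t c
    = (\<Sum>j = 0..<d. if j < k then real (p i j) * (- 2 * t * real (c j))
        else if j < 2 * k then (real (p i (j - k)))\<^sup>2 * t
        else if j = 2 * k then t * ((\<Sum>j<k. (real (c j))\<^sup>2) - 1 / 2)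
        else if j = 2 * k + 1 then of_bool (i \<in> S) * t else 0)"
    using assms by (auto simp: scalar_prod_def hard_matrix_def probe_def intro!: sum.cong)
  also have "\<dots> = (\<Sum>j<k. real (p i j) * (- 2 * t * real (c j))) + (\<Sum>j<k. (real (p i j))\<^sup>2 * t)
      + t * ((\<Sum>j<k. (real (c j))\<^sup>2) - 1 / 2) + of_bool (i \<in> S) * t"
    by (rule sum_blocks[OF assms(1), where g = "\<lambda>j. (real (p i j))\<^sup>2 * t"])
  also have "\<dots> = t * ((\<Sum>j<k. (real (p i j) - real (c j))\<^sup>2) - 1 / 2 + of_bool (i \<in> S))"
    by (simp add: power2_diff sum.distrib sum_subtractf sum_negf sum_distrib_left algebra_simps)
  finally show ?thesis .
qed

lemma logistic_loss_hard_matrix: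
  assumes "2 * k + 2 \<le> d"
  shows "logistic_loss (hard_matrix n d k p S) (ones n) (probe d k t c)
    = (\<Sum>i<n. ln (1 + exp (- (t * ((\<Sum>j<k. (real (p i j) - real (c j))\<^sup>2) - 1 / 2 + of_bool (i \<in> S))))))"
proof -
  have "dim_row (hard_matrix n d k p S) = n" by (simp add: hard_matrix_def)
  then show ?thesis
    using assms unfolding logistic_loss_def
    by (intro sum.cong) (simp_all add: hard_matrix_margin ones_def)
qed

text \<open>Row \<open>l\<close> has distance 0 and is not lifted, so its margin is
  \<open>- t / 2\<close> and its summand alone is at least \<open>ln 2\<close>.\<close>

lemma loss_ge_if_notin:
  assumes "2 * k + 2 \<le> d" and "l < n" and "l \<notin> S" and "0 \<le> t"
  shows "ln 2 \<le> logistic_loss (hard_matrix n d k p S) (ones n) (probe d k t (p l))"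
proof -
  define h where "h i = ln (1 + exp (- (t * ((\<Sum>j<k. (real (p i j) - real (p l j))\<^sup>2) - 1 / 2
    + of_bool (i \<in> S)))))" for i
  have "ln (1 + 1) \<le> h l"
    unfolding h_def using assms by (intro ln_mono add_left_mono) (auto simp: add_pos_pos)
  then have "ln 2 \<le> h l" by simp
  also have "h l \<le> (\<Sum>i<n. h i)"
    using assms(2) by (intro member_le_sum) (auto simp: h_def)
  finally show ?thesis using assms(1) by (simp add: logistic_loss_hard_matrix h_def)
qed

text \<open>All margins are at least \<open>t / 2\<close>: row \<open>l\<close> is lifted by its
  membership in \<open>S\<close>, and every other point is at squared distance at least 1. Then
  \<open>ln (1 + x) \<le> x\<close> bounds each summand.\<close>

lemma loss_le_if_in:
  assumes "2 * k + 2 \<le> d" and "l \<in> S" and "0 \<le> t"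
    and inj: "\<And>i. i < n \<Longrightarrow> i \<noteq> l \<Longrightarrow> \<exists>j<k. p i j \<noteq> p l j"
  shows "logistic_loss (hard_matrix n d k p S) (ones n) (probe d k t (p l)) \<le> n * exp (- t / 2)"
proof -
  have "ln (1 + exp (- (t * ((\<Sum>j<k. (real (p i j) - real (p l j))\<^sup>2) - 1 / 2 + of_bool (i \<in> S)))))
    \<le> exp (- t / 2)" (is "ln (1 + exp (- (t * ?m))) \<le> _") if "i < n" for i
  proof -
    have nonneg: "0 \<le> (\<Sum>j<k. (real (p i j) - real (p l j))\<^sup>2)" by (intro sum_nonneg) auto
    have "1 / 2 \<le> ?m"
    proof (cases "i = l")
      case False
      then obtain j where j: "j < k" "p i j \<noteq> p l j" using inj \<open>i < n\<close> by blast
      then have "1 \<le> \<bar>real (p i j) - real (p l j)\<bar>" by linarith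
      then have "1 \<le> (real (p i j) - real (p l j))\<^sup>2"
        using power_mono[of 1 "\<bar>real (p i j) - real (p l j)\<bar>" 2] by simp
      also have "\<dots> \<le> (\<Sum>j<k. (real (p i j) - real (p l j))\<^sup>2)"
        using j(1) by (intro member_le_sum) auto
      finally have "1 \<le> (\<Sum>j<k. (real (p i j) - real (p l j))\<^sup>2)" .
      then show ?thesis by simp
    qed (use \<open>l \<in> S\<close> in auto)
    then have "t * (1 / 2) \<le> t * ?m" using \<open>0 \<le> t\<close> by (rule mult_left_mono)
    then have "exp (- (t * ?m)) \<le> exp (- t / 2)" by simp
    moreover have "ln (1 + exp (- (t * ?m))) \<le> exp (- (t * ?m))"
      by (intro ln_add_one_self_le_self) simp
    ultimately show ?thesis by linarith
  qed
  then have "(\<Sum>i<n. ln (1 + exp (- (t * ((\<Sum>j<k. (real (p i j) - real (p l j))\<^sup>2) - 1 / 2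
    + of_bool (i \<in> S)))))) \<le> (\<Sum>i<n. exp (- t / 2))"
    by (intro sum_mono) auto
  then show ?thesis using assms(1) by (simp add: logistic_loss_hard_matrix)
qed

text \<open>At the query aimed at \<open>p l\<close> the losses are at most 1/6 for \<open>S\<close>
  and at least 2/3 for \<open>T\<close>. Even with \<open>\<epsilon> = 1 / 2\<close>, a common
  approximation would be at most 1/4 and at least 1/3.\<close>

lemma hard_matrices_separated:
  assumes "2 * k + 2 \<le> d" and "0 < \<epsilon>" and "\<epsilon> \<le> 1 / 2"
    and inj: "\<And>i l. i < n \<Longrightarrow> l < n \<Longrightarrow> i \<noteq> l \<Longrightarrow> \<exists>j<k. p i j \<noteq> p l j"
    and l: "l < n" "l \<in> S" "l \<notin> T"
    and S: "rel_error_approx \<epsilon> (hard_matrix n d k p S) (ones n) L"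
    and T: "rel_error_approx \<epsilon> (hard_matrix n d k p T) (ones n) L"
  shows False
proof -
  \<comment> \<open>Chosen so that \<open>n * exp (- t / 2)\<close> is 1/6. Queries are arbitrary
    real vectors, so \<open>t\<close> may grow with \<open>n\<close>.\<close>
  define t where "t = 2 * ln (6 * real n)"
  have "0 \<le> t" using l(1) by (simp add: t_def)
  have "exp (- t / 2) = 1 / (6 * real n)" using l(1) by (simp add: t_def exp_minus divide_simps)
  then have small: "real n * exp (- t / 2) = 1 / 6" using l(1) by simp
  let ?\<beta> = "probe d k t (p l)"
  let ?a = "logistic_loss (hard_matrix n d k p S) (ones n) ?\<beta>"
  let ?b = "logistic_loss (hard_matrix n d k p T) (ones n) ?\<beta>"
  have dim: "?\<beta> \<in> carrier_vec (dim_col (hard_matrix n d k p R))" for R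
    by (simp add: probe_def hard_matrix_def)
  have "?a \<le> 1 / 6"
    using loss_le_if_in[OF assms(1) l(2) \<open>0 \<le> t\<close>, of n p] inj l(1) small by auto
  have "2 / 3 \<le> ?b"
    using loss_ge_if_notin[OF assms(1) l(1,3) \<open>0 \<le> t\<close>, of p] ln2_ge_two_thirds by linarith
  have "1 / 2 * (2 / 3) \<le> (1 - \<epsilon>) * ?b"
    using \<open>2 / 3 \<le> ?b\<close> \<open>\<epsilon> \<le> 1 / 2\<close> by (intro mult_mono) auto
  also have "\<dots> \<le> L ?\<beta>" using T dim unfolding rel_error_approx_def by blast
  also have "\<dots> \<le> (1 + \<epsilon>) * ?a" using S dim unfolding rel_error_approx_def by blast
  also have "\<dots> \<le> (1 + \<epsilon>) * (1 / 6)"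
    using \<open>?a \<le> 1 / 6\<close> \<open>0 < \<epsilon>\<close> by (intro mult_left_mono) auto
  also have "\<dots> \<le> (3 / 2) * (1 / 6)" using \<open>\<epsilon> \<le> 1 / 2\<close> by (intro mult_right_mono) auto
  finally show False by simp
qed

section \<open>Admissible entries and enough grid points\<close>

lemma hard_matrix_in_inputs:
  assumes "1 \<le> n * d" and "0 < K"
    and "\<And>i j. i < n \<Longrightarrow> j < k \<Longrightarrow> (real (p i j))\<^sup>2 \<le> real (n * d) powr K"
  shows "(hard_matrix n d k p S, ones n) \<in> inputs K n d"
proof -
  have one: "1 \<le> real (n * d) powr K"
    using assms(1,2) by (intro ge_one_powr_ge_zero) (auto simp flip: of_nat_mult)
  have lin: "real (p i j) \<le> real (n * d) powr K" if "i < n" "j < k" for i j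
  proof -
    have "p i j \<le> (p i j)\<^sup>2" by (simp add: power2_eq_square)
    then have "real (p i j) \<le> (real (p i j))\<^sup>2" by (metis of_nat_mono of_nat_power)
    then show ?thesis using assms(3)[OF that] by linarith
  qed
  show ?thesis
    using one assms(3) lin unfolding inputs_def hard_matrix_def ones_def
    by (auto simp del: of_nat_mult)
qed

text \<open>The grid \<open>{..A}\<close> to the power \<open>k\<close> has at least
  \<open>(n * d) powr (K / 2 * k) \<ge> n * d \<ge> n\<close> points, so \<open>n\<close> distinct
  ones can be chosen.\<close>

lemma exists_grid_points:
  assumes "1 \<le> n * d" and "0 < K" and k: "2 / K \<le> real k"
  obtains p :: "nat \<Rightarrow> nat \<Rightarrow> nat"
  where "\<And>i j. i < n \<Longrightarrow> j < k \<Longrightarrow> (real (p i j))\<^sup>2 \<le> real (n * d) powr K"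
    and "\<And>i l. i < n \<Longrightarrow> l < n \<Longrightarrow> i \<noteq> l \<Longrightarrow> \<exists>j<k. p i j \<noteq> p l j"
proof -
  \<comment> \<open>The exponent is halved because squares of coordinates are entries too.\<close>
  define B where "B = real (n * d) powr (K / 2)"
  define A where "A = nat \<lfloor>B\<rfloor>"
  have N1: "1 \<le> real (n * d)" using assms(1) using of_nat_mono[OF assms(1), where ?'a = real] by simp
  have "0 \<le> B" by (simp add: B_def)
  have A: "real A \<le> B" "B \<le> real (A + 1)"
    using \<open>0 \<le> B\<close> unfolding A_def by linarith+
  have B2: "B\<^sup>2 = real (n * d) powr K"
    using N1 by (simp add: B_def powr_realpow[symmetric] powr_powr del: of_nat_mult)
  have "d \<ge> 1" using assms(1) by (cases d) auto
  then have "real n \<le> real (n * d)" by (metis of_nat_mono mult.right_neutral mult_le_mono2)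
  also have "\<dots> = real (n * d) powr 1" using N1 by simp
  also have "\<dots> \<le> real (n * d) powr (K / 2 * real k)"
    using N1 assms(2) k by (intro powr_mono) (auto simp: field_simps)
  also have "\<dots> = B ^ k"
    using N1 by (simp add: B_def powr_powr powr_realpow[symmetric] del: of_nat_mult)
  also have "\<dots> \<le> real (A + 1) ^ k" using A \<open>0 \<le> B\<close> by (intro power_mono) auto
  finally have "n \<le> (A + 1) ^ k" by (metis of_nat_le_iff of_nat_power)
  then have "card {..<n} \<le> card (PiE {..<k} (\<lambda>_. {..A}))"
    by (simp add: card_PiE)
  then obtain p where p: "p ` {..<n} \<subseteq> PiE {..<k} (\<lambda>_. {..A})" "inj_on p {..<n}"
    using card_le_inj[of "{..<n}" "PiE {..<k} (\<lambda>_. {..A})"] by (auto intro: finite_PiE)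
  show thesis
  proof
    fix i j assume "i < n" "j < k"
    then have "p i j \<le> A" using p(1) by (auto simp: PiE_iff image_subset_iff)
    then have "real (p i j) \<le> B" using A(1) by linarith
    then show "(real (p i j))\<^sup>2 \<le> real (n * d) powr K"
      unfolding B2[symmetric] by (intro power_mono) auto
  next
    fix i l assume il: "i < n" "l < n" "i \<noteq> l"
    show "\<exists>j<k. p i j \<noteq> p l j"
    proof (rule ccontr)
      assume "\<not> ?thesis"
      \<comment> \<open>Members of \<open>PiE\<close> are \<open>undefined\<close> outside
        \<open>{..<k}\<close>, so agreement below \<open>k\<close> is equality.\<close>
      then have "p i = p l" using p(1) il by (intro PiE_ext[of _ "{..<k}" "\<lambda>_. {..A}"]) auto
      then show False using p(2) il by (auto dest: inj_onD)
    qed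
  qed
qed

section \<open>From counting to the space bound\<close>

text \<open>If \<open>2 * s + 1 \<le> n\<close>, then \<open>x = 2 ^ s\<close> satisfies
  \<open>4 / 3 * x^2 - 2 * x + 1 \<le> 0\<close>, a quadratic with negative discriminant. The
  \<open>- 1\<close> in the count matters: it excludes \<open>n = 1\<close>,
  \<open>s = 0\<close>.\<close>

lemma linear_bound_of_counting:
  assumes "1 \<le> n" and "2 / 3 * 2 ^ n \<le> (2 :: real) ^ (s + 1) - 1"
  shows "real n / 2 \<le> real s"
proof (rule ccontr)
  assume "\<not> ?thesis"
  then have "2 * s + 1 \<le> n" by linarith
  then have "(2 :: real) ^ (2 * s + 1) \<le> 2 ^ n" by (intro power_increasing) auto
  moreover have "(2 :: real) ^ (2 * s + 1) = 2 * ((2 ^ s) * (2 ^ s))"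
    by (simp add: power_even_eq power2_eq_square)
  ultimately have "4 / 3 * ((2 :: real) ^ s * 2 ^ s) - 2 * 2 ^ s + 1 \<le> 0"
    using assms(2) by simp
  moreover have "4 / 3 * (x * x) - 2 * x + 1 = 4 / 3 * (x - 3 / 4)\<^sup>2 + 1 / 4" for x :: real
    by (simp add: power2_eq_square algebra_simps)
  ultimately have "4 / 3 * ((2 :: real) ^ s - 3 / 4)\<^sup>2 + 1 / 4 \<le> 0" by metis
  moreover have "0 \<le> ((2 :: real) ^ s - 3 / 4)\<^sup>2" by (rule zero_le_power2)
  ultimately show False by linarith
qed

theorem space_linear_in_number_of_rows:
  assumes "1 \<le> n" and "0 < K" and "2 / K \<le> real k" and "2 * k + 2 \<le> d"
    and "0 < \<epsilon>" and "\<epsilon> \<le> 1 / 2"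
    and "prob_space M" and "approximates_logistic_loss \<epsilon> K n d M" and "uses_space K n d M s"
  shows "real n / 2 \<le> real s"
proof -
  have nd: "1 \<le> n * d" using assms by simp
  obtain p where p: "\<And>i j. i < n \<Longrightarrow> j < k \<Longrightarrow> (real (p i j))\<^sup>2 \<le> real (n * d) powr K"
      "\<And>i l. i < n \<Longrightarrow> l < n \<Longrightarrow> i \<noteq> l \<Longrightarrow> \<exists>j<k. p i j \<noteq> p l j"
    using exists_grid_points[OF nd assms(2,3)] by blast
  have "2 / 3 * real (card (Pow {..<n})) \<le> 2 ^ (s + 1) - 1"
  proof (rule space_bound_of_packing[where X = "hard_matrix n d k p" and y = "\<lambda>_. ones n",
        OF assms(7,8,9)])
    fix S T L
    assume "S \<in> Pow {..<n}" "T \<in> Pow {..<n}"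
      and ST: "rel_error_approx \<epsilon> (hard_matrix n d k p S) (ones n) L"
        "rel_error_approx \<epsilon> (hard_matrix n d k p T) (ones n) L"
    then show "S = T"
      \<comment> \<open>Separation needs a row in one set but not in the other, and either set may
        be the one containing it.\<close>
      using hard_matrices_separated[OF assms(4-6) p(2) _ _ _ ST]
        hard_matrices_separated[OF assms(4-6) p(2) _ _ _ ST(2,1)] by blast
  qed (use hard_matrix_in_inputs[OF nd assms(2) p(1)] in auto)
  then show ?thesis using assms(1) by (intro linear_bound_of_counting) (simp_all add: card_Pow)
qed

theorem theorem1:
  fixes K C\<^sub>d C\<^sub>n :: real and a :: nat
  assumes "K > 0" and "C\<^sub>d > 0" and "C\<^sub>n > 0"
  shows "\<exists>\<epsilon>\<^sub>0 > 0. \<exists>c > 0. \<exists>b :: nat.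
    \<forall>(n :: nat) (d :: nat) (\<epsilon> :: real) (M :: data_structure measure) (s :: nat).
      n \<ge> 1 \<longrightarrow> d \<ge> 1 \<longrightarrow> 0 < \<epsilon> \<longrightarrow> \<epsilon> \<le> \<epsilon>\<^sub>0 \<longrightarrow>
      real d \<ge> C\<^sub>d * ln (1 / \<epsilon>) \<longrightarrow>
      real n \<ge> C\<^sub>n * (real d / \<epsilon>\<^sup>2) / polylog n d \<epsilon> a \<longrightarrow>
      prob_space M \<longrightarrow>
      approximates_logistic_loss \<epsilon> K n d M \<longrightarrow>
      uses_space K n d M s \<longrightarrow>
      real s \<ge> c * (real d / \<epsilon>\<^sup>2) / polylog n d \<epsilon> b"
proof -
  define k where "k = nat \<lceil>2 / K\<rceil>"
  have k: "2 / K \<le> real k" unfolding k_def by linarith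
  \<comment> \<open>The bound 1/2 serves the separation of losses; the exponential makes
    \<open>C\<^sub>d * ln (1 / \<epsilon>)\<close> at least \<open>2 * k + 2\<close>, so that all
    the columns fit.\<close>
  define \<epsilon>\<^sub>0 where "\<epsilon>\<^sub>0 = min (1 / 2) (exp (- (real (2 * k + 2) / C\<^sub>d)))"
  have dim: "2 * k + 2 \<le> d"
    if "0 < \<epsilon>" "\<epsilon> \<le> \<epsilon>\<^sub>0" "C\<^sub>d * ln (1 / \<epsilon>) \<le> real d" for \<epsilon> :: real and d
  proof -
    have "ln \<epsilon> \<le> ln (exp (- (real (2 * k + 2) / C\<^sub>d)))"
      using that(1,2) unfolding \<epsilon>\<^sub>0_def by (subst ln_le_cancel_iff) auto
    then have "real (2 * k + 2) / C\<^sub>d \<le> ln (1 / \<epsilon>)" using that(1) by (simp add: ln_div)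
    then have "real (2 * k + 2) \<le> C\<^sub>d * ln (1 / \<epsilon>)"
      using \<open>C\<^sub>d > 0\<close> by (simp add: divide_le_eq mult.commute)
    then show ?thesis using that(3) by linarith
  qed
  show ?thesis
  \<comment> \<open>Half the assumed lower bound on \<open>n\<close> is the claimed bound on
    \<open>s\<close>, with the same logarithmic factor.\<close>
  proof (rule exI[of _ \<epsilon>\<^sub>0], rule conjI[rotated],
      rule exI[of _ "C\<^sub>n / 2"], rule conjI[rotated], rule exI[of _ a], intro allI impI)
    fix n d s :: nat and \<epsilon> :: real and M :: "data_structure measure"
    assume n: "n \<ge> 1" and \<epsilon>: "0 < \<epsilon>" "\<epsilon> \<le> \<epsilon>\<^sub>0" and d: "real d \<ge> C\<^sub>d * ln (1 / \<epsilon>)"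
      and rows: "real n \<ge> C\<^sub>n * (real d / \<epsilon>\<^sup>2) / polylog n d \<epsilon> a"
      and M: "prob_space M" "approximates_logistic_loss \<epsilon> K n d M" "uses_space K n d M s"
    have "\<epsilon> \<le> 1 / 2" using \<epsilon>(2) by (simp add: \<epsilon>\<^sub>0_def)
    then have "real n / 2 \<le> real s"
      using space_linear_in_number_of_rows[OF n \<open>K > 0\<close> k dim[OF \<epsilon> d] \<epsilon>(1) _ M] by blast
    then show "real s \<ge> C\<^sub>n / 2 * (real d / \<epsilon>\<^sup>2) / polylog n d \<epsilon> a"
      using rows by (simp add: field_simps)
  qed (use \<open>C\<^sub>n > 0\<close> in \<open>auto simp: \<epsilon>\<^sub>0_def\<close>)
qed

end
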